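(* Let $N>k\ge 2$ be integers and $b=\lceil\log_2(N-k+1)\rceil$. For $i\in\{0,\dots,b-1\}$ let $\alpha^i=\left\lceil\frac{k-1+2^{b-i-1}}{2^{b-i}}\right\rceil$, and for integers $0\le p\le\min\{\alpha^i-1,2^i-1\}$ let $L^{i,p},R^{i,p}$ be the sets defined in the context. Then the following is an ideal MIP formulation of $\mathrm{SOS}k(N)$, in variables $\lambda\in\Delta^N$ and $z=(z_{i,p})$: $$\sum_{v\in L^{i,p}\cap\llbracket N\rrbracket}\lambda_v\le z_{i,p},\qquad \sum_{v\in R^{i,p}\cap\llbracket N\rrbracket}\lambda_v\le 1-z_{i,p},\qquad z_{i,p}\in\{0,1\},$$ for all $i\in\llbracket 0,b-1\rrbracket$ and $p\in\llbracket 0,\min\{\alpha^i-1,2^i-1\}\rrbracket$. Moreover, the number of binary variables in $z$ is at most $\lceil\log_2(N-k+1)\rceil+k-2$, and the number of displayed inequality constraints is at most $2\lceil\log_2(N-k+1)\rceil+2k-4$.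
   Context: Notation: $\llbracket N\rrbracket=\{1,\dots,N\}$; $\llbracket a,c\rrbracket=\{a,a+1,\dots,c\}$ (empty if $a>c$); $\Delta^N=\{\lambda\in\mathbb{R}^N_{\ge 0}:\sum_{i=1}^N\lambda_i=1\}$. For positive integers $k\le N$, $\mathrm{SOS}k(N):=\bigcup_{i=1}^{N-k+1}\{\lambda\in\Delta^N:\lambda_j=0\ \ \forall j\in\llbracket N\rrbracket\setminus\llbracket i,i+k-1\rrbracket\}$. For $i\in\{0,\dots,b-1\}$, $j\in\{0,\dots,2^i-1\}$ set $$A^{i,j}:=\llbracket 1+j2^{b-i},(2j+1)2^{b-i-1}\rrbracket,\qquad B^{i,j}:=\llbracket(2j+1)2^{b-i-1}+k,(j+1)2^{b-i}+k-1\rrbracket,$$ and $$L^{i,p}=\Big(\bigcup_{q=0}^{\lfloor\frac{2^i-1-p}{2\alpha^i}\rfloor}A^{i,2q\alpha^i+p}\Big)\cup\Big(\bigcup_{q=0}^{\lfloor\frac{2^i-1-p}{2\alpha^i}-\frac12\rfloor}B^{i,(2q+1)\alpha^i+p}\Big),$$ $$R^{i,p}=\Big(\bigcup_{q=0}^{\lfloor\frac{2^i-1-p}{2\alpha^i}\rfloor}B^{i,2q\alpha^i+p}\Big)\cup\Big(\bigcup_{q=0}^{\lfloor\frac{2^i-1-p}{2\alpha^i}-\frac12\rfloor}A^{i,(2q+1)\alpha^i+p}\Big),$$ where a union with negative upper limit is empty. A mixed-integer programming (MIP) formulation of $\mathrm{SOS}k(N)$ is a system such that $\lambda\in\mathrm{SOS}k(N)$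 if and only if there is a $z$ with $(\lambda,z)$ satisfying the system. It is ideal if each extreme point of its LP relaxation (obtained by dropping the integrality requirement on $z$, i.e. $0\le z\le 1$) satisfies the integrality conditions. *)

theory Defs
  imports "HOL-Analysis.Analysis" "HOL-Analysis.Finite_Function_Topology"
begin

text \<open>
  The index sets of the variables depend on \<open>N\<close> and \<open>k\<close>, so the space of real vectors indexed by a
  finite set \<open>I\<close> is represented by the finitely supported functions \<^typ>\<open>'i \<Rightarrow>\<^sub>0 real\<close> whose
  support (\<^term>\<open>Poly_Mapping.keys\<close>) is contained in \<open>I\<close>. This is a real vector space, so that
  \<^const>\<open>extreme_point_of\<close> applies to it.
\<close>

type_synonym lambda_vec = "nat \<Rightarrow>\<^sub>0 real"
type_synonym z_vec = "(nat \<times> nat) \<Rightarrow>\<^sub>0 real"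

definition unit_simplex :: "nat \<Rightarrow> lambda_vec set" where
  "unit_simplex N =
     {l. Poly_Mapping.keys l \<subseteq> {1..N} \<and> (\<forall>v\<in>{1..N}. 0 \<le> Poly_Mapping.lookup l v) \<and>
         (\<Sum>v\<in>{1..N}. Poly_Mapping.lookup l v) = 1}"

definition SOSk :: "nat \<Rightarrow> nat \<Rightarrow> lambda_vec set" where
  "SOSk k N =
     (\<Union>i\<in>{1..N - k + 1}. {l \<in> unit_simplex N. \<forall>j\<in>{1..N} - {i..i + k - 1}. Poly_Mapping.lookup l j = 0})"


definition depth :: "nat \<Rightarrow> nat \<Rightarrow> nat" where
  "depth N k = nat \<lceil>log 2 (real N - real k + 1)\<rceil>"

definition alpha :: "nat \<Rightarrow> nat \<Rightarrow> nat \<Rightarrow> nat" where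
  "alpha b k i = nat \<lceil>(real k - 1 + 2 ^ (b - i - 1)) / 2 ^ (b - i)\<rceil>"

definition A_set :: "nat \<Rightarrow> nat \<Rightarrow> nat \<Rightarrow> nat set" where
  "A_set b i j = {1 + j * 2 ^ (b - i) .. (2 * j + 1) * 2 ^ (b - i - 1)}"

definition B_set :: "nat \<Rightarrow> nat \<Rightarrow> nat \<Rightarrow> nat \<Rightarrow> nat set" where
  "B_set b k i j = {(2 * j + 1) * 2 ^ (b - i - 1) + k .. (j + 1) * 2 ^ (b - i) + k - 1}"

text \<open>
  The upper limits of the unions may be negative, hence the comparison in \<^typ>\<open>int\<close>; in that
  case the range of \<open>q\<close> is empty.
\<close>

definition even_range :: "nat \<Rightarrow> nat \<Rightarrow> nat \<Rightarrow> nat \<Rightarrow> nat set" where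
  "even_range b k i p =
     {q. int q \<le> \<lfloor>(2 ^ i - 1 - real p) / (2 * real (alpha b k i))\<rfloor>}"

definition odd_range :: "nat \<Rightarrow> nat \<Rightarrow> nat \<Rightarrow> nat \<Rightarrow> nat set" where
  "odd_range b k i p =
     {q. int q \<le> \<lfloor>(2 ^ i - 1 - real p) / (2 * real (alpha b k i)) - 1 / 2\<rfloor>}"

definition L_set :: "nat \<Rightarrow> nat \<Rightarrow> nat \<Rightarrow> nat \<Rightarrow> nat set" where
  "L_set b k i p =
     (\<Union>q\<in>even_range b k i p. A_set b i (2 * q * alpha b k i + p)) \<union>
     (\<Union>q\<in>odd_range b k i p. B_set b k i ((2 * q + 1) * alpha b k i + p))"

definition R_set :: "nat \<Rightarrow> nat \<Rightarrow> nat \<Rightarrow> nat \<Rightarrow> nat set" where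
  "R_set b k i p =
     (\<Union>q\<in>even_range b k i p. B_set b k i (2 * q * alpha b k i + p)) \<union>
     (\<Union>q\<in>odd_range b k i p. A_set b i ((2 * q + 1) * alpha b k i + p))"

text \<open>
  The natural-number subtraction \<open>alpha - 1\<close> does not truncate: \<open>alpha \<ge> 1\<close> whenever \<open>k \<ge> 1\<close>.
\<close>

definition z_index :: "nat \<Rightarrow> nat \<Rightarrow> (nat \<times> nat) set" where
  "z_index N k =
     {(i, p). i < depth N k \<and> p \<le> min (alpha (depth N k) k i - 1) (2 ^ i - 1)}"


datatype side = Left_side | Right_side

definition ineq_index :: "nat \<Rightarrow> nat \<Rightarrow> ((nat \<times> nat) \<times> side) set" where
  "ineq_index N k = z_index N k \<times> {Left_side, Right_side}"

fun ineq_holds :: "nat \<Rightarrow> nat \<Rightarrow> (nat \<times> nat) \<times> side \<Rightarrow> lambda_vec \<Rightarrow> z_vec \<Rightarrow> bool" where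
  "ineq_holds N k ((i, p), Left_side) l z \<longleftrightarrow>
     (\<Sum>v\<in>L_set (depth N k) k i p \<inter> {1..N}. Poly_Mapping.lookup l v) \<le> Poly_Mapping.lookup z (i, p)"
| "ineq_holds N k ((i, p), Right_side) l z \<longleftrightarrow>
     (\<Sum>v\<in>R_set (depth N k) k i p \<inter> {1..N}. Poly_Mapping.lookup l v) \<le> 1 - Poly_Mapping.lookup z (i, p)"

text \<open>
  The parameter \<open>D\<close> is the domain of each variable \<open>z\<^sub>i\<^sub>,\<^sub>p\<close>: \<open>{0, 1}\<close> for the mixed-integer system and
  \<open>{0..1}\<close> for its LP relaxation.
\<close>

definition solutions :: "nat \<Rightarrow> nat \<Rightarrow> real set \<Rightarrow> (lambda_vec \<times> z_vec) set" where
  "solutions N k D =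
     {(l, z). l \<in> unit_simplex N \<and>
              Poly_Mapping.keys z \<subseteq> z_index N k \<and> (\<forall>j\<in>z_index N k. Poly_Mapping.lookup z j \<in> D) \<and>
              (\<forall>c\<in>ineq_index N k. ineq_holds N k c l z)}"

abbreviation mip_solutions :: "nat \<Rightarrow> nat \<Rightarrow> (lambda_vec \<times> z_vec) set" where
  "mip_solutions N k \<equiv> solutions N k {0, 1}"

abbreviation lp_relaxation :: "nat \<Rightarrow> nat \<Rightarrow> (lambda_vec \<times> z_vec) set" where
  "lp_relaxation N k \<equiv> solutions N k {0..1}"


definition is_formulation_of :: "('x \<times> 'z) set \<Rightarrow> 'x set \<Rightarrow> bool" where
  "is_formulation_of M S \<longleftrightarrow> (\<forall>x. x \<in> S \<longleftrightarrow> (\<exists>z. (x, z) \<in> M))"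

definition is_ideal ::
  "(('v \<Rightarrow>\<^sub>0 real) \<times> ('w \<Rightarrow>\<^sub>0 real)) set \<Rightarrow> 'w set \<Rightarrow> bool" where
  "is_ideal Q J \<longleftrightarrow>
     (\<forall>x z. (x, z) extreme_point_of Q \<longrightarrow> (\<forall>j\<in>J. Poly_Mapping.lookup z j \<in> {0, 1}))"

end

theory Submission
  imports Defs
begin

text \<open>
  Two entries are in conflict if no window of length \<open>k\<close> contains both, so \<open>\<lambda>\<close> lies in \<open>SOSk\<close> iff its
  support has no conflict. Every element of \<open>L\<^sup>i\<^sup>,\<^sup>p\<close> is in conflict with every element of \<open>R\<^sup>i\<^sup>,\<^sup>p\<close>
  (\<open>\<alpha>\<^sup>i\<close> is just large enough for this), and conversely a conflict \<open>u + k \<le> v\<close> is separated by the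
  dyadic interval of least length containing both \<open>u - 1\<close> and \<open>v - k\<close>. Idealness holds for every
  system of this shape with \<open>L\<^sub>j\<close> and \<open>R\<^sub>j\<close> disjoint: a point of the relaxation is a convex combination
  of points whose \<open>\<lambda>\<close>-part is a unit vector, and there each \<open>z\<^sub>j\<close> ranges over \<open>{0}\<close>, \<open>{1}\<close> or \<open>[0,1]\<close>. The size bound is
  the telescoping identity \<open>\<lfloor>n / 2\<^sup>m + 1 / 2\<rfloor> = \<lfloor>n / 2\<^sup>m\<^sup>-\<^sup>1\<rfloor> - \<lfloor>n / 2\<^sup>m\<rfloor>\<close> with \<open>n = k - 2\<close>.
\<close>

section \<open>Systems given by pairs of disjoint sets\<close>

text \<open>The index type and the two families are left arbitrary, so that convexity, idealness and
  the meaning of binary solutions can be proved without any arithmetic of \<open>L_set\<close> and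
  \<open>R_set\<close>.\<close>

definition pair_system ::
  "nat \<Rightarrow> 'j set \<Rightarrow> ('j \<Rightarrow> nat set) \<Rightarrow> ('j \<Rightarrow> nat set) \<Rightarrow> real set \<Rightarrow> (lambda_vec \<times> ('j \<Rightarrow>\<^sub>0 real)) set" where
  "pair_system N J L R D =
     {(l, z). l \<in> unit_simplex N \<and> Poly_Mapping.keys z \<subseteq> J \<and>
        (\<forall>j\<in>J. Poly_Mapping.lookup z j \<in> D \<and>
               (\<Sum>v\<in>L j \<inter> {1..N}. Poly_Mapping.lookup l v) \<le> Poly_Mapping.lookup z j \<and>
               (\<Sum>v\<in>R j \<inter> {1..N}. Poly_Mapping.lookup l v) \<le> 1 - Poly_Mapping.lookup z j)}"

section \<open>Coordinates of finitely supported vectors\<close>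

lemma lookup_scaleR [simp]:
  "Poly_Mapping.lookup (c *\<^sub>R x) i = c *\<^sub>R Poly_Mapping.lookup x i"
proof -
  have "finite {i. c *\<^sub>R Poly_Mapping.lookup x i \<noteq> 0}"
    by (rule finite_subset[OF _ finite_lookup[of x]]) auto
  then show ?thesis
    by (simp add: scaleR_poly_mapping_def Abs_poly_mapping_inverse)
qed

lemma lookup_sum_single:
  assumes "finite J"
  shows "Poly_Mapping.lookup (\<Sum>j\<in>J. Poly_Mapping.single j (f j)) i = (if i \<in> J then f i else 0)"
  using assms by (simp add: lookup_sum lookup_single when_def)

lemma sum_lookup_single:
  fixes N :: nat
  shows "(\<Sum>u\<in>S \<inter> {1..N}. Poly_Mapping.lookup (Poly_Mapping.single v (1::real)) u)
     = (if v \<in> S \<inter> {1..N} then 1 else 0)"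
  by (simp add: lookup_single when_def)

lemma keys_subset_iff:
  "Poly_Mapping.keys z \<subseteq> J \<longleftrightarrow> (\<forall>j. j \<notin> J \<longrightarrow> Poly_Mapping.lookup z j = 0)"
  by (auto simp: in_keys_iff)

section \<open>Convexity of the solution sets\<close>

lemma convex_unit_simplex: "convex (unit_simplex N)"
proof (rule convexI)
  fix x y :: lambda_vec and u v :: real
  assume *: "x \<in> unit_simplex N" "y \<in> unit_simplex N" "0 \<le> u" "0 \<le> v" "u + v = 1"
  then show "u *\<^sub>R x + v *\<^sub>R y \<in> unit_simplex N"
    by (auto simp: unit_simplex_def keys_subset_iff lookup_add sum.distrib sum_distrib_left[symmetric])
qed

lemma convex_pair_system:
  assumes "convex D"
  shows "convex (pair_system N J L R D)"
proof (rule convexI)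
  fix x y :: "lambda_vec \<times> ('a \<Rightarrow>\<^sub>0 real)" and u v :: real
  assume x: "x \<in> pair_system N J L R D" and y: "y \<in> pair_system N J L R D"
    and uv: "0 \<le> u" "0 \<le> v" "u + v = 1"
  obtain l z l' z' where xy: "x = (l, z)" "y = (l', z')"
    by (metis surj_pair)
  have simplex: "u *\<^sub>R l + v *\<^sub>R l' \<in> unit_simplex N"
    using x y uv convexD[OF convex_unit_simplex] by (auto simp: pair_system_def xy)
  have sums: "(\<Sum>i\<in>S. Poly_Mapping.lookup (u *\<^sub>R l + v *\<^sub>R l') i)
      = u * (\<Sum>i\<in>S. Poly_Mapping.lookup l i) + v * (\<Sum>i\<in>S. Poly_Mapping.lookup l' i)" for S
    by (simp add: lookup_add sum.distrib sum_distrib_left)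
  have look: "Poly_Mapping.lookup (u *\<^sub>R z + v *\<^sub>R z') j
      = u * Poly_Mapping.lookup z j + v * Poly_Mapping.lookup z' j" for j
    by (simp add: lookup_add)
  have "u * Poly_Mapping.lookup z j + v * Poly_Mapping.lookup z' j \<in> D" if "j \<in> J" for j
    using convexD[OF assms, of "Poly_Mapping.lookup z j" "Poly_Mapping.lookup z' j" u v] x y uv that
    by (auto simp: pair_system_def xy)
  moreover have "u * a + v * a' \<le> u * c + v * c'"
    if "a \<le> c" "a' \<le> c'" for a a' c c' :: real
    using that uv by (simp add: add_mono mult_left_mono)
  moreover have "u * a + v * a' \<le> 1 - (u * c + v * c')"
    if "a \<le> 1 - c" "a' \<le> 1 - c'" for a a' c c' :: real
  proof -
    have "u * a + v * a' \<le> u * (1 - c) + v * (1 - c')"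
      using that uv by (simp add: add_mono mult_left_mono)
    then show ?thesis
      using uv by (simp add: algebra_simps)
  qed
  ultimately show "u *\<^sub>R x + v *\<^sub>R y \<in> pair_system N J L R D"
    using x y simplex
    by (auto simp: pair_system_def xy sums look keys_subset_iff)
qed

section \<open>Extreme points of the relaxation and idealness\<close>

lemma single_in_unit_simplex:
  "v \<in> {1..N} \<Longrightarrow> Poly_Mapping.single v 1 \<in> unit_simplex N"
  by (auto simp: unit_simplex_def lookup_single when_def)

text \<open>Over a vertex of the simplex each sum is 0 or 1, so an inequality is either vacuous or
  fixes its variable. The fibre is therefore a product of \<open>{0}\<close>, \<open>{1}\<close> and
  \<open>{0..1}\<close>.\<close>

lemma single_in_pair_system_iff:
  assumes "v \<in> {1..N}"
  shows "(Poly_Mapping.single v 1, z) \<in> pair_system N J L R {0..1} \<longleftrightarrow>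
     Poly_Mapping.keys z \<subseteq> J \<and>
     (\<forall>j\<in>J. Poly_Mapping.lookup z j \<in> {0..1} \<and>
        (v \<in> L j \<longrightarrow> Poly_Mapping.lookup z j = 1) \<and> (v \<in> R j \<longrightarrow> Poly_Mapping.lookup z j = 0))"
proof -
  have forced: "x \<in> {0..1} \<and> (if a then 1 else 0) \<le> x \<and> (if c then 1 else 0) \<le> 1 - x \<longleftrightarrow>
      x \<in> {0..1} \<and> (a \<longrightarrow> x = 1) \<and> (c \<longrightarrow> x = 0)" for x :: real and a c
    by (cases a; cases c) auto
  have "v \<in> S \<inter> {1..N} \<longleftrightarrow> v \<in> S" for S
    using assms by blast
  then show ?thesis
    using single_in_unit_simplex[OF assms]
    by (simp only: pair_system_def mem_Collect_eq prod.case sum_lookup_single forced simp_thms)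
qed


text \<open>The point is a combination, with weights \<open>?l v\<close>, of points
  \<open>y v\<close> of the system lying over the vertices. Removing an extreme point leaves a
  convex set, so the \<open>y v\<close> cannot all differ from it.\<close>

lemma extreme_point_pair_system_single:
  assumes "finite J" and disj: "\<And>j. j \<in> J \<Longrightarrow> L j \<inter> R j = {}"
    and ext: "(l, z) extreme_point_of pair_system N J L R {0..1}"
  obtains v where "v \<in> {1..N}" "l = Poly_Mapping.single v 1"
proof -
  let ?P = "pair_system N J L R {0..1}"
  let ?l = "Poly_Mapping.lookup l" and ?z = "Poly_Mapping.lookup z"
  define wL wR where "wL j = (\<Sum>v\<in>L j \<inter> {1..N}. ?l v)" and "wR j = (\<Sum>v\<in>R j \<inter> {1..N}. ?l v)" for j
  \<comment> \<open>Giving the value 1 on \<open>L j\<close> accounts for \<open>wL j\<close>; the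
    rest \<open>?z j - wL j\<close> is spread evenly over the weight \<open>1 - wL j - wR j\<close>
    outside both sets. If that weight is 0, the inequalities force \<open>?z j = wL j\<close> and
    the default 0 is harmless.\<close>
  define t where "t j = (if wL j + wR j = 1 then 0 else (?z j - wL j) / (1 - wL j - wR j))" for j
  define f where "f v j = (if v \<in> L j then 1 else if v \<in> R j then 0 else t j)" for v j
  define Z where "Z v = (\<Sum>j\<in>J. Poly_Mapping.single j (f v j))" for v
  define y where "y v = (Poly_Mapping.single v (1::real), Z v)" for v
  have lookup_Z: "Poly_Mapping.lookup (Z v) j = (if j \<in> J then f v j else 0)" for v j
    by (simp add: Z_def lookup_sum_single[OF \<open>finite J\<close>])
  have lz: "(l, z) \<in> ?P" and conv: "convex (?P - {(l, z)})"
    using extreme_point_of_stillconvex[OF convex_pair_system[OF convex_real_interval(5)], THEN iffD1, OF ext]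
    by auto
  have l: "l \<in> unit_simplex N" and z: "Poly_Mapping.keys z \<subseteq> J"
    and zL: "\<And>j. j \<in> J \<Longrightarrow> wL j \<le> ?z j" and zR: "\<And>j. j \<in> J \<Longrightarrow> wR j \<le> 1 - ?z j"
    using lz by (auto simp: pair_system_def wL_def wR_def)
  have t: "0 \<le> t j" "t j \<le> 1" if "j \<in> J" for j
    using zL[OF that] zR[OF that] by (auto simp: t_def divide_simps)
  have yP: "y v \<in> ?P" if "v \<in> {1..N}" for v
    unfolding y_def single_in_pair_system_iff[OF that]
    using t disj by (auto simp: keys_subset_iff lookup_Z f_def)
  have split_sum: "(\<Sum>v\<in>{1..N}. ?l v * f v j) = ?z j" if j: "j \<in> J" for j
  proof -
    \<comment> \<open>By disjointness, \<open>f v j\<close> is the indicator of \<open>L j\<close>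
      plus \<open>t j\<close> times the indicator of the complement of both sets.\<close>
    have "?l v * f v j = (if v \<in> L j then ?l v else 0)
        + t j * (?l v - (if v \<in> L j then ?l v else 0) - (if v \<in> R j then ?l v else 0))" for v
      using disj[OF j] by (auto simp: f_def)
    moreover have "(\<Sum>v\<in>{1..N}. if v \<in> S then ?l v else 0) = (\<Sum>v\<in>S \<inter> {1..N}. ?l v)" for S
      by (simp add: sum.If_cases Int_commute)
    ultimately have "(\<Sum>v\<in>{1..N}. ?l v * f v j) = wL j + t j * ((\<Sum>v\<in>{1..N}. ?l v) - wL j - wR j)"
      by (simp add: sum.distrib sum_subtractf wL_def wR_def flip: sum_distrib_left)
    also have "\<dots> = wL j + t j * (1 - wL j - wR j)"
      using l by (simp add: unit_simplex_def)
    also have "\<dots> = ?z j"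
      using zL[OF j] zR[OF j] by (auto simp: t_def)
    finally show ?thesis .
  qed
  have sum_eq: "(\<Sum>v\<in>{1..N}. ?l v *\<^sub>R y v) = (l, z)"
  proof (rule prod_eqI)
    have "?l v * (if v = u then 1 else 0) = (if v = u then ?l v else 0)" for u v
      by simp
    then show "fst (\<Sum>v\<in>{1..N}. ?l v *\<^sub>R y v) = fst (l, z)"
      using l by (auto simp: fst_sum y_def lookup_sum lookup_single when_def unit_simplex_def
          keys_subset_iff intro!: poly_mapping_eqI)
    show "snd (\<Sum>v\<in>{1..N}. ?l v *\<^sub>R y v) = snd (l, z)"
    proof (rule poly_mapping_eqI)
      fix j
      show "Poly_Mapping.lookup (snd (\<Sum>v\<in>{1..N}. ?l v *\<^sub>R y v)) j = Poly_Mapping.lookup (snd (l, z)) j"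
        using z split_sum[of j]
        by (cases "j \<in> J") (auto simp: snd_sum y_def lookup_sum lookup_Z keys_subset_iff)
    qed
  qed
  have "\<exists>v\<in>{1..N}. y v = (l, z)"
  proof (rule ccontr)
    assume "\<not> (\<exists>v\<in>{1..N}. y v = (l, z))"
    then have "(\<Sum>v\<in>{1..N}. ?l v *\<^sub>R y v) \<in> ?P - {(l, z)}"
      using l yP by (intro convex_sum conv) (auto simp: unit_simplex_def)
    then show False
      unfolding sum_eq by simp
  qed
  then show thesis
    using that by (auto simp: y_def)
qed

text \<open>Over a unit vector a fractional coordinate is not fixed by either inequality. Rounding
  it to 0 and to 1 gives two other feasible points with the original between them, contradicting
  extremality.\<close>

lemma is_ideal_pair_system:
  assumes fin: "finite J" and disj: "\<And>j. j \<in> J \<Longrightarrow> L j \<inter> R j = {}"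
  shows "is_ideal (pair_system N J L R {0..1}) J"
  unfolding is_ideal_def
proof (intro allI impI ballI)
  fix l :: lambda_vec and z j
  let ?P = "pair_system N J L R {0..1}"
  assume ext: "(l, z) extreme_point_of ?P" and j: "j \<in> J"
  obtain v where v: "v \<in> {1..N}" and l: "l = Poly_Mapping.single v 1"
    using extreme_point_pair_system_single[OF fin disj ext] by blast
  have P: "(Poly_Mapping.single v 1, z) \<in> ?P" and conv: "convex (?P - {(l, z)})"
    using extreme_point_of_stillconvex[OF convex_pair_system[OF convex_real_interval(5)], THEN iffD1, OF ext]
    by (auto simp: l)
  note P = P[unfolded single_in_pair_system_iff[OF v]]
  show "Poly_Mapping.lookup z j \<in> {0, 1}"
  proof (rule ccontr)
    assume frac: "Poly_Mapping.lookup z j \<notin> {0, 1}"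
    define s where "s = Poly_Mapping.lookup z j"
    define y where "y c = z + Poly_Mapping.single j (c - s)" for c
    have look: "Poly_Mapping.lookup (y c) i = (if i = j then c else Poly_Mapping.lookup z i)" for c i
      by (auto simp: y_def lookup_add lookup_single when_def s_def)
    have mem: "(l, y c) \<in> ?P - {(l, z)}" if "c \<in> {0, 1}" for c
    proof -
      have "(l, y c) \<in> ?P"
        unfolding l single_in_pair_system_iff[OF v]
        using P j frac that by (auto simp: look keys_subset_iff)
      moreover have "y c \<noteq> z"
        using look[of c j] frac that by auto
      ultimately show ?thesis by simp
    qed
    have "(1 - s) *\<^sub>R (l, y 0) + s *\<^sub>R (l, y 1) \<in> ?P - {(l, z)}"
      using P j by (intro convexD[OF conv] mem) (auto simp: s_def)
    moreover have "(1 - s) *\<^sub>R y 0 + s *\<^sub>R y 1 = z"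
      by (rule poly_mapping_eqI) (simp add: lookup_add look s_def left_diff_distrib)
    moreover have "(1 - s) *\<^sub>R l + s *\<^sub>R l = l"
      by (simp flip: scaleR_add_left)
    ultimately show False
      by simp
  qed
qed

section \<open>Projection of the binary solutions\<close>

text \<open>The value 0 of \<open>z\<close> at \<open>j\<close> makes \<open>l\<close> vanish on
  \<open>L j\<close>, the value 1 makes it vanish on \<open>R j\<close>. Conversely, 0 is chosen
  exactly when \<open>l\<close> vanishes on \<open>L j\<close>.\<close>

lemma pair_system_binary_iff:
  assumes fin: "finite J"
  shows "(\<exists>z. (l, z) \<in> pair_system N J L R {0, 1}) \<longleftrightarrow>
    l \<in> unit_simplex N \<and>
    (\<forall>j\<in>J. \<forall>u\<in>L j \<inter> {1..N}. \<forall>v\<in>R j \<inter> {1..N}.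
       Poly_Mapping.lookup l u = 0 \<or> Poly_Mapping.lookup l v = 0)" (is "?lhs \<longleftrightarrow> ?rhs")
proof
  assume ?lhs
  then obtain z where z: "(l, z) \<in> pair_system N J L R {0, 1}" ..
  have zero: "\<forall>v\<in>S \<inter> {1..N}. Poly_Mapping.lookup l v = 0"
    if "(\<Sum>v\<in>S \<inter> {1..N}. Poly_Mapping.lookup l v) \<le> 0" for S
  proof -
    have nonneg: "0 \<le> Poly_Mapping.lookup l v" if "v \<in> S \<inter> {1..N}" for v
      using z that by (auto simp: pair_system_def unit_simplex_def)
    then have "(\<Sum>v\<in>S \<inter> {1..N}. Poly_Mapping.lookup l v) = 0"
      using that by (intro antisym sum_nonneg)
    then show ?thesis
      using nonneg by (subst (asm) sum_nonneg_eq_0_iff) auto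
  qed
  have "(\<forall>u\<in>L j \<inter> {1..N}. Poly_Mapping.lookup l u = 0) \<or> (\<forall>v\<in>R j \<inter> {1..N}. Poly_Mapping.lookup l v = 0)"
    if "j \<in> J" for j
  proof -
    have "Poly_Mapping.lookup z j = 0 \<or> Poly_Mapping.lookup z j = 1"
      and sums: "(\<Sum>v\<in>L j \<inter> {1..N}. Poly_Mapping.lookup l v) \<le> Poly_Mapping.lookup z j"
        "(\<Sum>v\<in>R j \<inter> {1..N}. Poly_Mapping.lookup l v) \<le> 1 - Poly_Mapping.lookup z j"
      using z that by (auto simp: pair_system_def)
    then show ?thesis
    proof (elim disjE)
      assume "Poly_Mapping.lookup z j = 0"
      then show ?thesis
        using sums(1) by (intro disjI1 zero) simp
    next
      assume "Poly_Mapping.lookup z j = 1"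
      then show ?thesis
        using sums(2) by (intro disjI2 zero) simp
    qed
  qed
  moreover have "l \<in> unit_simplex N"
    using z by (simp add: pair_system_def)
  ultimately show ?rhs
    by blast
next
  assume rhs: ?rhs
  define miss where "miss j \<longleftrightarrow> (\<forall>u\<in>L j \<inter> {1..N}. Poly_Mapping.lookup l u = 0)" for j
  define z where "z = (\<Sum>j\<in>J. Poly_Mapping.single j (if miss j then 0 else 1 :: real))"
  have le1: "(\<Sum>v\<in>S \<inter> {1..N}. Poly_Mapping.lookup l v) \<le> 1" for S
  proof -
    have "(\<Sum>v\<in>S \<inter> {1..N}. Poly_Mapping.lookup l v) \<le> (\<Sum>v\<in>{1..N}. Poly_Mapping.lookup l v)"
      using rhs by (intro sum_mono2) (auto simp: unit_simplex_def)
    then show ?thesis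
      using rhs by (simp add: unit_simplex_def)
  qed
  have "(\<Sum>v\<in>R j \<inter> {1..N}. Poly_Mapping.lookup l v) = 0" if "j \<in> J" "\<not> miss j" for j
    using rhs that by (intro sum.neutral) (auto simp: miss_def)
  moreover have "(\<Sum>v\<in>L j \<inter> {1..N}. Poly_Mapping.lookup l v) = 0" if "miss j" for j
    using that by (intro sum.neutral) (auto simp: miss_def)
  ultimately have "(l, z) \<in> pair_system N J L R {0, 1}"
    using rhs le1 by (auto simp: pair_system_def z_def keys_subset_iff lookup_sum_single[OF fin])
  then show ?lhs ..
qed

lemma solutions_eq_pair_system:
  "solutions N k D = pair_system N (z_index N k)
     (\<lambda>(i, p). L_set (depth N k) k i p) (\<lambda>(i, p). R_set (depth N k) k i p) D"
proof -
  have "(\<forall>c\<in>ineq_index N k. ineq_holds N k c l z) \<longleftrightarrow>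
      (\<forall>(i, p)\<in>z_index N k. ineq_holds N k ((i, p), Left_side) l z \<and> ineq_holds N k ((i, p), Right_side) l z)"
    for l z
    by (auto simp: ineq_index_def)
  then show ?thesis
    by (auto simp: solutions_def pair_system_def)
qed


section \<open>Conflicts and the special ordered set\<close>

text \<open>Without conflicts, the support lies within \<open>k\<close> consecutive positions
  starting at its least element.\<close>

lemma SOSk_iff:
  assumes "k \<ge> 1" "k \<le> N"
  shows "l \<in> SOSk k N \<longleftrightarrow> l \<in> unit_simplex N \<and>
    (\<forall>u\<in>{1..N}. \<forall>v\<in>{1..N}. u + k \<le> v \<longrightarrow> Poly_Mapping.lookup l u = 0 \<or> Poly_Mapping.lookup l v = 0)"
    (is "?lhs \<longleftrightarrow> ?rhs")
proof
  assume ?lhs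
  then obtain i where i: "l \<in> unit_simplex N" "\<forall>j\<in>{1..N} - {i..i + k - 1}. Poly_Mapping.lookup l j = 0"
    by (auto simp: SOSk_def)
  have "Poly_Mapping.lookup l u = 0 \<or> Poly_Mapping.lookup l v = 0"
    if uv: "u \<in> {1..N}" "v \<in> {1..N}" "u + k \<le> v" for u v
  proof -
    have "u \<in> {1..N} - {i..i + k - 1} \<or> v \<in> {1..N} - {i..i + k - 1}"
      using uv by auto
    then show ?thesis
      using i(2) by blast
  qed
  with i(1) show ?rhs by blast
next
  assume rhs: ?rhs
  then have "(\<Sum>v\<in>{1..N}. Poly_Mapping.lookup l v) = 1"
    by (simp add: unit_simplex_def)
  then have "(\<Sum>v\<in>{1..N}. Poly_Mapping.lookup l v) \<noteq> 0"
    by simp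
  from sum.not_neutral_contains_not_neutral[OF this]
  have ex: "\<exists>u. u \<in> {1..N} \<and> Poly_Mapping.lookup l u \<noteq> 0"
    by blast
  define u where "u = (LEAST u. u \<in> {1..N} \<and> Poly_Mapping.lookup l u \<noteq> 0)"
  have u: "u \<in> {1..N}" "Poly_Mapping.lookup l u \<noteq> 0"
    using LeastI_ex[OF ex] by (auto simp: u_def)
  have supp: "u \<le> j \<and> j < u + k" if "j \<in> {1..N}" "Poly_Mapping.lookup l j \<noteq> 0" for j
  proof
    show "u \<le> j"
      unfolding u_def using that by (intro Least_le) simp
    show "j < u + k"
    proof (rule ccontr)
      assume "\<not> j < u + k"
      then have "Poly_Mapping.lookup l u = 0 \<or> Poly_Mapping.lookup l j = 0"
        using rhs u(1) that(1) by simp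
      then show False
        using u(2) that(2) by simp
    qed
  qed
  \<comment> \<open>The cap keeps the window inside \<open>{1..N}\<close>. A capped window ends
    exactly at \<open>N\<close>, so it still contains the support.\<close>
  define i where "i = min u (N - k + 1)"
  have "Poly_Mapping.lookup l j = 0" if "j \<in> {1..N} - {i..i + k - 1}" for j
  proof (rule ccontr)
    assume "Poly_Mapping.lookup l j \<noteq> 0"
    then have "u \<le> j" "j < u + k"
      using supp[of j] that by auto
    moreover have "j \<le> N" "\<not> (i \<le> j \<and> j \<le> i + k - 1)"
      using that by auto
    ultimately show False
      using assms unfolding i_def by linarith
  qed
  moreover have "i \<in> {1..N - k + 1}"
    using u by (auto simp: i_def)
  ultimately show ?lhs
    using rhs unfolding SOSk_def by blast
qed

section \<open>The spacing \<alpha> and the conflict between opposite sides\<close>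

text \<open>With \<open>a = k - 2 + 2 ^ (b - i - 1)\<close> this is the rule that the ceiling of
  \<open>(a + 1) / d\<close> equals \<open>a div d + 1\<close>. It moves all later work into natural
  number arithmetic.\<close>

lemma alpha_eq_div:
  assumes "2 \<le> k"
  shows "alpha b k i = (k - 2 + 2 ^ (b - i - 1)) div 2 ^ (b - i) + 1"
proof -
  define a d :: nat where "a = k - 2 + 2 ^ (b - i - 1)" and "d = 2 ^ (b - i)"
  have d: "d > 0" by (simp add: d_def)
  have "d * (a div d) < a + 1"
    using times_div_less_eq_dividend[of d a] by linarith
  moreover have "a + 1 \<le> d * (a div d + 1)"
    using dividend_less_times_div[OF d, of a] by simp
  ultimately
  have "real d * real (a div d) < real a + 1" "real a + 1 \<le> real d * (real (a div d) + 1)"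
    by (metis of_nat_less_iff of_nat_mult of_nat_Suc Suc_eq_plus1 add.commute,
        metis of_nat_le_iff of_nat_mult of_nat_Suc Suc_eq_plus1 add.commute)
  then have "\<lceil>(real a + 1) / real d\<rceil> = int (a div d) + 1"
    using d by (intro ceiling_unique) (simp_all add: field_simps)
  moreover have "real k - 1 + 2 ^ (b - i - 1) = real a + 1"
    using assms by (simp add: a_def)
  moreover have "2 ^ (b - i) = real d"
    by (simp add: d_def)
  ultimately have "alpha b k i = nat (int (a div d) + 1)"
    by (simp only: alpha_def)
  then have "alpha b k i = a div d + 1"
    by simp
  then show ?thesis
    by (simp add: a_def d_def)
qed

lemma alpha_pos: "2 \<le> k \<Longrightarrow> alpha b k i > 0"
  by (simp add: alpha_eq_div)

lemma alpha_ge: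
  assumes "2 \<le> k" "i < b"
  shows "k - 1 + 2 ^ (b - i - 1) \<le> alpha b k i * 2 ^ (b - i)"
proof -
  have "k - 2 + 2 ^ (b - i - 1) < 2 ^ (b - i) * alpha b k i"
    using dividend_less_times_div[of "2 ^ (b - i)" "k - 2 + 2 ^ (b - i - 1)"] assms
    by (simp add: alpha_eq_div)
  then show ?thesis
    using assms(1) by (subst mult.commute) linarith
qed

text \<open>Blocks of the same kind occur on opposite sides only for multipliers of \<alpha> of
  different parity, hence at index distance at least \<alpha>. An A-block and a B-block meet only
  for equal parity: either the A-index is at most the B-index, or it exceeds it by at least
  \<open>2 * \<alpha>\<close>. Each case leaves a gap of at least \<open>k\<close>.\<close>

lemma L_R_conflict:
  assumes "2 \<le> k" "i < b" "u \<in> L_set b k i p" "v \<in> R_set b k i p"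
  shows "u + k \<le> v \<or> v + k \<le> u"
proof -
  define h \<alpha> where "h = (2::nat) ^ (b - i - 1)" and "\<alpha> = alpha b k i"
  have m: "2 ^ (b - i) = 2 * h"
    using assms(2) by (simp add: h_def Suc_diff_Suc flip: power_Suc)
  have \<alpha>: "k - 1 + h \<le> 2 * (\<alpha> * h)"
    using alpha_ge[OF assms(1,2)] unfolding m h_def[symmetric] \<alpha>_def[symmetric] by (simp add: ac_simps)
  have A: "A_set b i j = {1 + 2 * (j * h) .. 2 * (j * h) + h}" for j
    unfolding A_set_def m h_def[symmetric] by (simp add: algebra_simps)
  have B: "B_set b k i j = {2 * (j * h) + h + k .. 2 * (j * h) + 2 * h + k - 1}" for j
    unfolding B_set_def m h_def[symmetric] by (simp add: algebra_simps)
  \<comment> \<open>Supplies the products with \<open>h\<close> as atoms, so that linear arithmetic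
    settles the block comparisons.\<close>
  have mono: "i * h + j * h \<le> i' * h" if "i + j \<le> i'" for i j i'
    using mult_le_mono1[OF that, of h] by (simp add: algebra_simps)
  have AA: "x + k \<le> y" if "x \<in> A_set b i j" "y \<in> A_set b i j'" "j + \<alpha> \<le> j'" for x y j j'
    using that(1,2) \<alpha> mono[OF that(3)] assms(1) unfolding A atLeastAtMost_iff by linarith
  have BB: "x + k \<le> y" if "x \<in> B_set b k i j" "y \<in> B_set b k i j'" "j + \<alpha> \<le> j'" for x y j j'
    using that(1,2) \<alpha> mono[OF that(3)] assms(1) unfolding B atLeastAtMost_iff by linarith
  have AB: "x + k \<le> y \<or> y + k \<le> x"
    if "x \<in> A_set b i j" "y \<in> B_set b k i j'" "j \<le> j' \<or> j' + 2 * \<alpha> \<le> j" for x y j j'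
    using that(3)
  proof
    assume "j \<le> j'"
    then show ?thesis
      using that(1,2) mono[of j 0 j'] unfolding A B atLeastAtMost_iff by linarith
  next
    assume "j' + 2 * \<alpha> \<le> j"
    from mono[OF this] show ?thesis
      using that(1,2) \<alpha> assms(1) unfolding A B atLeastAtMost_iff by linarith
  qed
  have far: "m * \<alpha> + p + c * \<alpha> \<le> n * \<alpha> + p" if "m + c \<le> n" for m n c
    using mult_le_mono1[OF that, of \<alpha>] by (simp add: algebra_simps)
  have same: "m * \<alpha> + p \<le> n * \<alpha> + p \<or> n * \<alpha> + p + 2 * \<alpha> \<le> m * \<alpha> + p" if "even (m + n)" for m n
  proof -
    have "m \<le> n \<or> n + 2 \<le> m"
      using that by presburger
    then show ?thesis
      using far[of n 2 m] mult_le_mono1[of m n \<alpha>] by auto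
  qed
  have opp: "m * \<alpha> + p + \<alpha> \<le> n * \<alpha> + p \<or> n * \<alpha> + p + \<alpha> \<le> m * \<alpha> + p" if "odd (m + n)" for m n
  proof -
    have "m + 1 \<le> n \<or> n + 1 \<le> m"
      using that by presburger
    then show ?thesis
      using far[of n 1 m] far[of m 1 n] by auto
  qed
  \<comment> \<open>The bounds on \<open>q\<close> are forgotten here; only the parity of the
    multiplier \<open>m\<close> matters for conflicts.\<close>
  have u: "\<exists>m. even m \<and> u \<in> A_set b i (m * \<alpha> + p) \<or> odd m \<and> u \<in> B_set b k i (m * \<alpha> + p)"
    using assms(3) unfolding L_set_def \<alpha>_def[symmetric]
  proof (elim UnE UN_E)
    fix q
    assume "u \<in> A_set b i (2 * q * \<alpha> + p)"
    then show ?thesis by (intro exI[of _ "2 * q"]) simp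
  next
    fix q
    assume "u \<in> B_set b k i ((2 * q + 1) * \<alpha> + p)"
    then show ?thesis by (intro exI[of _ "2 * q + 1"]) simp
  qed
  have v: "\<exists>m. even m \<and> v \<in> B_set b k i (m * \<alpha> + p) \<or> odd m \<and> v \<in> A_set b i (m * \<alpha> + p)"
    using assms(4) unfolding R_set_def \<alpha>_def[symmetric]
  proof (elim UnE UN_E)
    fix q
    assume "v \<in> B_set b k i (2 * q * \<alpha> + p)"
    then show ?thesis by (intro exI[of _ "2 * q"]) simp
  next
    fix q
    assume "v \<in> A_set b i ((2 * q + 1) * \<alpha> + p)"
    then show ?thesis by (intro exI[of _ "2 * q + 1"]) simp
  qed
  obtain m n where
    "even m \<and> u \<in> A_set b i (m * \<alpha> + p) \<or> odd m \<and> u \<in> B_set b k i (m * \<alpha> + p)"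
    "even n \<and> v \<in> B_set b k i (n * \<alpha> + p) \<or> odd n \<and> v \<in> A_set b i (n * \<alpha> + p)"
    using u v by blast
  then consider
      "u \<in> A_set b i (m * \<alpha> + p)" "v \<in> B_set b k i (n * \<alpha> + p)" "even (m + n)"
    | "u \<in> A_set b i (m * \<alpha> + p)" "v \<in> A_set b i (n * \<alpha> + p)" "odd (m + n)"
    | "u \<in> B_set b k i (m * \<alpha> + p)" "v \<in> B_set b k i (n * \<alpha> + p)" "odd (m + n)"
    | "u \<in> B_set b k i (m * \<alpha> + p)" "v \<in> A_set b i (n * \<alpha> + p)" "even (n + m)"
    by auto
  then show ?thesis
  proof cases
    case 1
    then show ?thesis using AB same by blast
  next
    case 2
    then show ?thesis using AA opp by blast
  next
    case 3
    then show ?thesis using BB opp by blast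
  next
    case 4
    then show ?thesis using AB same by blast
  qed
qed

section \<open>Covering every conflict by a dyadic interval\<close>

text \<open>In \<open>b\<close>-bit expansions, \<open>i\<close> is the length of the longest common
  prefix of \<open>u\<close> and \<open>v\<close>, and \<open>j\<close> is its value. At the next
  bit \<open>u\<close> has 0 and \<open>v\<close> has 1. The induction strips the last bit.\<close>

lemma dyadic_separation:
  fixes u v :: nat
  assumes "u < v" "v < 2 ^ b"
  shows "\<exists>i<b. \<exists>j<2 ^ i. j * 2 ^ (b - i) \<le> u \<and> u < (2 * j + 1) * 2 ^ (b - i - 1) \<and>
           (2 * j + 1) * 2 ^ (b - i - 1) \<le> v \<and> v < (j + 1) * 2 ^ (b - i)"
  using assms
proof (induction b arbitrary: u v)
  case 0
  then show ?case by simp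
next
  case (Suc b)
  show ?case
  proof (cases "u div 2 = v div 2")
    case True
    then have "u = 2 * (u div 2)" "v = 2 * (u div 2) + 1" "u div 2 < 2 ^ b"
      using Suc.prems by auto
    then show ?thesis
      \<comment> \<open>Only the last bit differs, so the prefix has length \<open>b\<close> and
        each half of the interval is a single point.\<close>
      by (intro exI[of _ b] conjI exI[of _ "u div 2"]) auto
  next
    case False
    then have "u div 2 < v div 2" "v div 2 < 2 ^ b"
      using Suc.prems by auto
    from Suc.IH[OF this] obtain i j where ij: "i < b" "j < 2 ^ i"
      "j * 2 ^ (b - i) \<le> u div 2" "u div 2 < (2 * j + 1) * 2 ^ (b - i - 1)"
      "(2 * j + 1) * 2 ^ (b - i - 1) \<le> v div 2" "v div 2 < (j + 1) * 2 ^ (b - i)"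
      by blast
    \<comment> \<open>Every new bound is twice the old one, hence even, so the comparisons pass from
      \<open>u div 2\<close> and \<open>v div 2\<close> to \<open>u\<close> and
      \<open>v\<close>.\<close>
    have double: "x * 2 ^ (Suc c) = 2 * (x * 2 ^ c)" for x c :: nat
      by simp
    have "Suc b - i = Suc (b - i)" "Suc b - i - 1 = Suc (b - i - 1)"
      using ij(1) by auto
    then have "j * 2 ^ (Suc b - i) \<le> u \<and> u < (2 * j + 1) * 2 ^ (Suc b - i - 1) \<and>
           (2 * j + 1) * 2 ^ (Suc b - i - 1) \<le> v \<and> v < (j + 1) * 2 ^ (Suc b - i)"
      using ij(3-6) unfolding double by (simp only: double) linarith
    then show ?thesis
      using ij(1,2) less_SucI by blast
  qed
qed

lemma even_rangeI:
  assumes "2 \<le> k" "2 * q * alpha b k i + p < 2 ^ i"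
  shows "q \<in> even_range b k i p"
proof -
  have "2 * q * alpha b k i + p + 1 \<le> 2 ^ i"
    using assms(2) by simp
  then have "real (2 * q * alpha b k i + p + 1) \<le> real (2 ^ i)"
    by (simp only: of_nat_le_iff)
  then show ?thesis
    using alpha_pos[OF assms(1), of b i] by (simp add: even_range_def le_floor_iff field_simps)
qed

lemma odd_rangeI:
  assumes "2 \<le> k" "(2 * q + 1) * alpha b k i + p < 2 ^ i"
  shows "q \<in> odd_range b k i p"
proof -
  have "(2 * q + 1) * alpha b k i + p + 1 \<le> 2 ^ i"
    using assms(2) by simp
  then have "real ((2 * q + 1) * alpha b k i + p + 1) \<le> real (2 ^ i)"
    by (simp only: of_nat_le_iff)
  then show ?thesis
    using alpha_pos[OF assms(1), of b i] by (simp add: odd_range_def le_floor_iff field_simps)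
qed

text \<open>Writing \<open>j = m * \<alpha> + p\<close> with \<open>p = j mod \<alpha>\<close> finds
  the class containing \<open>j\<close>. The parity of \<open>m\<close> decides whether the A-block
  falls on the left or on the right.\<close>

lemma A_B_cover:
  assumes "2 \<le> k" "j < 2 ^ i" "u \<in> A_set b i j" "v \<in> B_set b k i j"
  obtains p where "p \<le> min (alpha b k i - 1) (2 ^ i - 1)"
    "u \<in> L_set b k i p \<and> v \<in> R_set b k i p \<or> v \<in> L_set b k i p \<and> u \<in> R_set b k i p"
proof
  define \<alpha> p m where "\<alpha> = alpha b k i" and "p = j mod \<alpha>" and "m = j div \<alpha>"
  have j: "j = m * \<alpha> + p"
    by (simp add: p_def m_def)
  have "p < \<alpha>" "p \<le> j"
    using alpha_pos[OF assms(1)] by (auto simp: p_def \<alpha>_def)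
  then show "p \<le> min (alpha b k i - 1) (2 ^ i - 1)"
    using assms(2) by (auto simp: \<alpha>_def)
  show "u \<in> L_set b k i p \<and> v \<in> R_set b k i p \<or> v \<in> L_set b k i p \<and> u \<in> R_set b k i p"
  proof (cases "even m")
    case True
    then obtain q where q: "m = 2 * q" by blast
    then have "q \<in> even_range b k i p"
      using assms(1,2) by (intro even_rangeI) (simp_all add: j \<alpha>_def)
    then show ?thesis
      using assms(3,4) by (auto simp: L_set_def R_set_def j q \<alpha>_def)
  next
    case False
    then obtain q where q: "m = 2 * q + 1" by (blast elim: oddE)
    then have "q \<in> odd_range b k i p"
      using assms(1,2) by (intro odd_rangeI) (simp_all add: j \<alpha>_def)
    then show ?thesis
      using assms(3,4) unfolding L_set_def R_set_def j q \<alpha>_def by blast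
  qed
qed

lemma depth_eq:
  assumes "k < N"
  shows "int (depth N k) = \<lceil>log 2 (real N - real k + 1)\<rceil>" "N - k + 1 \<le> 2 ^ depth N k"
proof -
  have "0 \<le> log 2 (real N - real k + 1)"
    using assms by simp
  then show eq: "int (depth N k) = \<lceil>log 2 (real N - real k + 1)\<rceil>"
    by (simp add: depth_def)
  then have "log 2 (real N - real k + 1) \<le> real (depth N k)"
    by linarith
  then have "real N - real k + 1 \<le> 2 powr real (depth N k)"
    using assms by (subst (asm) log_le_iff) auto
  then have "real (N - k + 1) \<le> real (2 ^ depth N k)"
    using assms by (simp add: of_nat_diff powr_realpow)
  then show "N - k + 1 \<le> 2 ^ depth N k"
    by (simp only: of_nat_le_iff)
qed

text \<open>\<open>A_set\<close> is the lower half of a dyadic interval shifted by 1 and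
  \<open>B_set\<close> its upper half shifted by \<open>k\<close>. A conflict of \<open>u\<close>
  and \<open>v\<close> thus becomes the strict inequality \<open>u - 1 < v - k\<close> between
  \<open>b\<close>-bit numbers.\<close>

lemma conflict_cover:
  assumes "2 \<le> k" "k < N" "u \<ge> 1" "u + k \<le> v" "v \<le> N"
  obtains i p where "(i, p) \<in> z_index N k"
    "u \<in> L_set (depth N k) k i p \<and> v \<in> R_set (depth N k) k i p \<or>
     v \<in> L_set (depth N k) k i p \<and> u \<in> R_set (depth N k) k i p"
proof -
  let ?b = "depth N k"
  have "u - 1 < v - k" "v - k < 2 ^ ?b"
    using assms depth_eq(2)[OF assms(2)] by linarith+
  from dyadic_separation[OF this] obtain i j where ij: "i < ?b" "j < 2 ^ i"
    "j * 2 ^ (?b - i) \<le> u - 1" "u - 1 < (2 * j + 1) * 2 ^ (?b - i - 1)"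
    "(2 * j + 1) * 2 ^ (?b - i - 1) \<le> v - k" "v - k < (j + 1) * 2 ^ (?b - i)"
    by blast
  have "u \<in> A_set ?b i j"
    using ij(3,4) assms(3) unfolding A_set_def atLeastAtMost_iff by linarith
  moreover have "v \<in> B_set ?b k i j"
    using ij(5,6) assms(3,4) unfolding B_set_def atLeastAtMost_iff by linarith
  ultimately show thesis
    using A_B_cover[OF assms(1) ij(2)] that ij(1) unfolding z_index_def by blast
qed


section \<open>Size of the formulation\<close>

lemma z_index_eq_Sigma:
  "z_index N k = (SIGMA i:{..<depth N k}. {..min (alpha (depth N k) k i - 1) (2 ^ i - 1)})"
  by (auto simp: z_index_def)

text \<open>Both summands depend on \<open>n\<close> only through \<open>q = n div 2 ^ m\<close>,
  where the claim reads \<open>(q + 1) div 2 + q div 2 = q\<close>.\<close>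

lemma div_pow2_round:
  "(n + 2 ^ m) div 2 ^ Suc m + n div 2 ^ Suc m = n div 2 ^ m" for n :: nat
proof -
  have "(n + 2 ^ m) div 2 ^ Suc m = (n div 2 ^ m + 1) div 2"
    by (simp add: div_mult2_eq mult.commute[of 2])
  moreover have "n div 2 ^ Suc m = n div 2 ^ m div 2"
    by (simp add: div_mult2_eq mult.commute[of 2])
  ultimately show ?thesis
    by simp
qed

text \<open>Keeping the remainder \<open>n div 2 ^ b\<close> makes the telescoping exact; dropping
  it bounds the sum by \<open>n\<close>.\<close>

lemma sum_div_pow2_round:
  "(\<Sum>m<b. (n + 2 ^ m) div 2 ^ Suc m) + n div 2 ^ b = n" for n :: nat
proof (induction b)
  case (Suc b)
  then show ?case
    using div_pow2_round[of n b] by simp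
qed simp

lemma card_z_index:
  assumes "2 \<le> k"
  shows "card (z_index N k) \<le> depth N k + (k - 2)"
proof -
  let ?b = "depth N k"
  have "card (z_index N k) = (\<Sum>i<?b. Suc (min (alpha ?b k i - 1) (2 ^ i - 1)))"
    by (simp add: z_index_eq_Sigma)
  also have "\<dots> \<le> (\<Sum>i<?b. 1 + (k - 2 + 2 ^ (?b - i - 1)) div 2 ^ (?b - i))"
    using assms by (intro sum_mono) (simp add: alpha_eq_div)
  \<comment> \<open>Exponents are written with \<open>?b - Suc i\<close> so that reversing the order
    of summation applies.\<close>
  also have "\<dots> = ?b + (\<Sum>i<?b. (k - 2 + 2 ^ (?b - Suc i)) div 2 ^ Suc (?b - Suc i))"
    unfolding sum.distrib by (simp add: Suc_diff_Suc)
  also have "(\<Sum>i<?b. (k - 2 + 2 ^ (?b - Suc i)) div 2 ^ Suc (?b - Suc i))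
      = (\<Sum>m<?b. (k - 2 + 2 ^ m) div 2 ^ Suc m)"
    by (rule sum.nat_diff_reindex)
  finally show ?thesis
    using sum_div_pow2_round[where n = "k - 2" and b = ?b] by linarith
qed

section \<open>Combining validity, idealness and size\<close>

theorem theorem6:
  fixes N k :: nat
  assumes "2 \<le> k" and "k < N"
  shows "is_formulation_of (mip_solutions N k) (SOSk k N) \<and>
         is_ideal (lp_relaxation N k) (z_index N k) \<and>
         int (card (z_index N k)) \<le> \<lceil>log 2 (real N - real k + 1)\<rceil> + int k - 2 \<and>
         int (card (ineq_index N k)) \<le> 2 * \<lceil>log 2 (real N - real k + 1)\<rceil> + 2 * int k - 4"
proof -
  let ?L = "\<lambda>(i, p). L_set (depth N k) k i p" and ?R = "\<lambda>(i, p). R_set (depth N k) k i p"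
  have fin: "finite (z_index N k)"
    by (simp add: z_index_eq_Sigma)
  have conflict: "u + k \<le> v \<or> v + k \<le> u" if "j \<in> z_index N k" "u \<in> ?L j" "v \<in> ?R j" for j u v
  proof -
    obtain i p where j: "j = (i, p)"
      by (cases j)
    then have "i < depth N k"
      using that(1) by (simp add: z_index_def)
    then show ?thesis
      using that(2,3) j L_R_conflict[OF assms(1), of i "depth N k" u p v] by simp
  qed
  have "l \<in> SOSk k N \<longleftrightarrow> (\<exists>z. (l, z) \<in> mip_solutions N k)" for l
  proof -
    let ?free = "\<lambda>u v. Poly_Mapping.lookup l u = 0 \<or> Poly_Mapping.lookup l v = 0"
    have "(\<forall>u\<in>{1..N}. \<forall>v\<in>{1..N}. u + k \<le> v \<longrightarrow> ?free u v) \<longleftrightarrow>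
        (\<forall>j\<in>z_index N k. \<forall>u\<in>?L j \<inter> {1..N}. \<forall>v\<in>?R j \<inter> {1..N}. ?free u v)" (is "?lhs \<longleftrightarrow> ?rhs")
    proof
      assume ?lhs
      then show ?rhs
        using conflict by blast
    next
      assume rhs: ?rhs
      show ?lhs
      proof (intro ballI impI)
        fix u v
        assume uv: "u \<in> {1..N}" "v \<in> {1..N}" "u + k \<le> v"
        then obtain i p where "(i, p) \<in> z_index N k"
          "u \<in> ?L (i, p) \<and> v \<in> ?R (i, p) \<or> v \<in> ?L (i, p) \<and> u \<in> ?R (i, p)"
          \<comment> \<open>The smaller entry may lie on either side; this is harmless because
            \<open>?free\<close> is symmetric.\<close>
          using conflict_cover[OF assms, of u v] by auto
        then show "?free u v"
          using rhs uv(1,2) by blast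
      qed
    qed
    then show ?thesis
      using assms by (simp add: SOSk_iff solutions_eq_pair_system pair_system_binary_iff[OF fin])
  qed
  moreover have "is_ideal (lp_relaxation N k) (z_index N k)"
    unfolding solutions_eq_pair_system
  proof (intro is_ideal_pair_system fin)
    fix j
    assume j: "j \<in> z_index N k"
    \<comment> \<open>A common element would be in conflict with itself, which is impossible for
      positive \<open>k\<close>.\<close>
    have "\<not> (v \<in> ?L j \<and> v \<in> ?R j)" for v
      using conflict[OF j, of v v] assms(1) by linarith
    then show "?L j \<inter> ?R j = {}"
      by blast
  qed
  moreover have "int (card (z_index N k)) \<le> \<lceil>log 2 (real N - real k + 1)\<rceil> + int k - 2"
    using card_z_index[OF assms(1), of N] depth_eq(1)[OF assms(2)] assms(1) by linarith
  moreover have "card (ineq_index N k) = 2 * card (z_index N k)"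
    by (simp add: ineq_index_def card_cartesian_product)
  ultimately show ?thesis
    by (simp add: is_formulation_of_def)
qed

end
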